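(* Let $n\ge 1$, $V=\{1,\dots,n\}$, $0<\alpha_i<1$ for $i\in V$, $M,C>0$, and let $\mathbf q'\in\mathbb R^n_+$ satisfy $\sum_{i=1}^n q'_i=1$ and $q'_1<q'_2<\dots<q'_n$. Consider the zero-sum quiz show game with fixed consolation prizes described in the context. Let $$N=\max\Big\{k\in V:\ \sum_{j=1}^{k-1}(q'_k-q'_j)\frac{1-\alpha_j}{\alpha_j}\le \frac{M}{C}\Big\}.$$ For $i=1,\dots,N$ let $\sigma_i$ be the permutation $(n,n-1,\dots,N+1,i,i+1,\dots,N,1,\dots,i-1)$ (the list gives the order in which the questions are answered). Then: (1) It is optimal for the contestant to use the mixed strategy $\mathbf x^*=\sum_{i=1}^N p_i^*\mathbf x^{\sigma_i}$ which chooses $\sigma_i$ with probability $$p_i^*=\frac{(1-\alpha_i)/\alpha_i}{\sum_{j=1}^N(1-\alpha_j)/\alpha_j},\qquad i=1,\dots,N.$$ (2) It is optimal for the host to use the strategy $\mathbf y^*$ which allocates all the main prize money $M$ to question $i\in V$ with probability $q_i^*$, where $$q_i^*=\frac{C(1-\alpha_i)}{M\alpha_i\sum_{j=1}^N\frac{1-\alpha_j}{\alpha_j}}\left(\frac MC+\sum_{j=1}^N\frac{(1-\alpha_j)q'_j}{\alpha_j}-q'_i\sum_{j=1}^N\frac{1-\alpha_j}{\alpha_j}\right)\quad\text{for } i=1,\dots,N,$$ and $q_i^*=0$ for $i>N$. (3) The value of the game is $$v=\Big(\prod_{j=N+1}^n\alpha_j\Big)\frac{1-\prod_{j=1}^N\alpha_j}{\sum_{j=1}^N(1-\alpha_j)/\alpha_j}\Big(M+C\sum_{j=1}^N\frac{1-\alpha_j}{\alpha_j}q'_j\Big)+C\sum_{j=N+1}^n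 q'_j(1-\alpha_j)\prod_{i=j+1}^n\alpha_i .$$
   Context: Quiz show game with fixed consolation prizes. There are $n$ questions $V=\{1,\dots,n\}$. The contestant (Player 1, maximizer) chooses a permutation $\sigma$ of $V$, where $\sigma(i)$ is the $i$-th question answered. The host (Player 2, minimizer) chooses $\mathbf q\in\mathbb R^n_+$ with $\sum_i q_i=1$; the main prize of question $i$ is $q_iM$. The consolation prize of question $i$ is $q'_iC$, where $M,C>0$ and $\mathbf q'$ are fixed parameters. When question $i$ is attempted, the contestant answers it correctly with probability $\alpha_i$ (independently), receives $q_iM$ and proceeds to the next question in her order; with probability $1-\alpha_i$ she answers incorrectly, receives $q'_iC$ and the game ends. The payoff is the contestant's expected total winnings. For a permutation $\sigma$ define $\mathbf x^\sigma\in\mathbb R^n$ by $x_i^\sigma=(1-\alpha_i)\prod_{j:\,\sigma^{-1}(j)<\sigma^{-1}(i)}\alpha_j$. A mixed strategy choosing $\sigma$ with probability $p_\sigma$ is identified with $\mathbf x=\sum_\sigma p_\sigma\mathbf x^\sigma$. The host's choice $\mathbf q$ (equivalently, by linearity, the mixed strategy which puts all of $M$ on question $i$ with probability $q_i$) is identified with $\mathbf y\in\mathbb R^n$, $y_i=\frac{\alpha_i}{1-\alpha_i}q_iM+q'_iC$. The expected payoff is $\mathbf x^T\mathbf y$. A contestant strategy is optimal if it attains $\max_{\mathbf x}\min_{\mathbf y}\mathbf x^T\mathbf y$, a host strategy is optimal if it attains $\min_{\mathbf y}\max_{\mathbf x}\mathbf x^T\mathbf y$, and the common value of these two quantities is the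 value of the game. Empty sums are $0$ and empty products are $1$. *)

theory Defs
  imports "HOL-Probability.Probability" "HOL-Combinatorics.Permutations"
begin

(* Vectors indexed by the questions V = {1..n} are functions nat => real, of which only the
   values on {1..n} matter; an order of the questions is a permutation of {1..n}, with sigma i
   the i-th question answered. *)

definition payoff :: "nat \<Rightarrow> (nat \<Rightarrow> real) \<Rightarrow> (nat \<Rightarrow> real) \<Rightarrow> real" where
  "payoff n x y = (\<Sum>i=1..n. x i * y i)"

definition contestant_vec :: "nat \<Rightarrow> (nat \<Rightarrow> real) \<Rightarrow> (nat \<Rightarrow> nat) \<Rightarrow> nat \<Rightarrow> real" where
  "contestant_vec n \<alpha> \<sigma> i =
     (1 - \<alpha> i) * (\<Prod>j\<in>{j \<in> {1..n}. inv \<sigma> j < inv \<sigma> i}. \<alpha> j)"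

definition host_vec ::
  "(nat \<Rightarrow> real) \<Rightarrow> real \<Rightarrow> real \<Rightarrow> (nat \<Rightarrow> real) \<Rightarrow> (nat \<Rightarrow> real) \<Rightarrow> nat \<Rightarrow> real" where
  "host_vec \<alpha> M C q' q i = \<alpha> i / (1 - \<alpha> i) * q i * M + q' i * C"

definition contestant_strategies :: "nat \<Rightarrow> (nat \<Rightarrow> real) \<Rightarrow> (nat \<Rightarrow> real) set" where
  "contestant_strategies n \<alpha> =
     {\<lambda>i. \<Sum>\<sigma> | \<sigma> permutes {1..n}. p \<sigma> * contestant_vec n \<alpha> \<sigma> i | p.
       (\<forall>\<sigma>. \<sigma> permutes {1..n} \<longrightarrow> 0 \<le> p \<sigma>) \<and> (\<Sum>\<sigma> | \<sigma> permutes {1..n}. p \<sigma>) = 1}"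

definition host_strategies ::
  "nat \<Rightarrow> (nat \<Rightarrow> real) \<Rightarrow> real \<Rightarrow> real \<Rightarrow> (nat \<Rightarrow> real) \<Rightarrow> (nat \<Rightarrow> real) set" where
  "host_strategies n \<alpha> M C q' =
     {host_vec \<alpha> M C q' q | q. (\<forall>i\<in>{1..n}. 0 \<le> q i) \<and> (\<Sum>i=1..n. q i) = 1}"

(* The inner infima and suprema are attained, i.e. they are minima and maxima: see
   host_best_response and contestant_best_response below. *)

definition maximin :: "nat \<Rightarrow> (nat \<Rightarrow> real) \<Rightarrow> real \<Rightarrow> real \<Rightarrow> (nat \<Rightarrow> real) \<Rightarrow> real" where
  "maximin n \<alpha> M C q' =
     (SUP x\<in>contestant_strategies n \<alpha>. INF y\<in>host_strategies n \<alpha> M C q'. payoff n x y)"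

definition minimax :: "nat \<Rightarrow> (nat \<Rightarrow> real) \<Rightarrow> real \<Rightarrow> real \<Rightarrow> (nat \<Rightarrow> real) \<Rightarrow> real" where
  "minimax n \<alpha> M C q' =
     (INF y\<in>host_strategies n \<alpha> M C q'. SUP x\<in>contestant_strategies n \<alpha>. payoff n x y)"

definition optimal_contestant ::
  "nat \<Rightarrow> (nat \<Rightarrow> real) \<Rightarrow> real \<Rightarrow> real \<Rightarrow> (nat \<Rightarrow> real) \<Rightarrow> (nat \<Rightarrow> real) \<Rightarrow> bool" where
  "optimal_contestant n \<alpha> M C q' x \<longleftrightarrow>
     x \<in> contestant_strategies n \<alpha> \<and>
     (INF y\<in>host_strategies n \<alpha> M C q'. payoff n x y) = maximin n \<alpha> M C q'"

definition optimal_host ::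
  "nat \<Rightarrow> (nat \<Rightarrow> real) \<Rightarrow> real \<Rightarrow> real \<Rightarrow> (nat \<Rightarrow> real) \<Rightarrow> (nat \<Rightarrow> real) \<Rightarrow> bool" where
  "optimal_host n \<alpha> M C q' y \<longleftrightarrow>
     y \<in> host_strategies n \<alpha> M C q' \<and>
     (SUP x\<in>contestant_strategies n \<alpha>. payoff n x y) = minimax n \<alpha> M C q'"

definition is_game_value ::
  "nat \<Rightarrow> (nat \<Rightarrow> real) \<Rightarrow> real \<Rightarrow> real \<Rightarrow> (nat \<Rightarrow> real) \<Rightarrow> real \<Rightarrow> bool" where
  "is_game_value n \<alpha> M C q' v \<longleftrightarrow> maximin n \<alpha> M C q' = v \<and> minimax n \<alpha> M C q' = v"

definition cyclic_order :: "nat \<Rightarrow> nat \<Rightarrow> nat \<Rightarrow> nat list" where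
  "cyclic_order n N i = rev [N + 1..<n + 1] @ [i..<N + 1] @ [1..<i]"

(* The permutation whose i-th value is the i-th list entry, counting from 1. *)

definition perm_of_order :: "nat list \<Rightarrow> nat \<Rightarrow> nat" where
  "perm_of_order xs k = (if k \<in> {1..length xs} then xs ! (k - 1) else k)"

lemma perm_of_order_permutes:
  assumes "distinct xs" and "set xs = {1..n}"
  shows "perm_of_order xs permutes {1..n}"
proof -
  have len: "length xs = n"
    using distinct_card[OF assms(1)] assms(2) by simp
  have "inj_on (perm_of_order xs) {1..n}"
    using assms(1) len
    by (auto simp: inj_on_def perm_of_order_def nth_eq_iff_index_eq)
  moreover have "perm_of_order xs ` {1..n} \<subseteq> {1..n}"
  proof
    fix y assume "y \<in> perm_of_order xs ` {1..n}"
    then obtain k where k: "k \<in> {1..n}" "y = perm_of_order xs k" by blast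
    then have "y = xs ! (k - 1)" "k - 1 < length xs"
      using len by (auto simp: perm_of_order_def)
    then show "y \<in> {1..n}" using assms(2) nth_mem by metis
  qed
  ultimately have "bij_betw (perm_of_order xs) {1..n} {1..n}"
    by (simp add: bij_betw_def endo_inj_surj)
  then show ?thesis
    by (rule bij_imp_permutes) (auto simp: perm_of_order_def len)
qed

lemma cyclic_order_permutes:
  assumes "1 \<le> i" "i \<le> N" "N \<le> n"
  shows "perm_of_order (cyclic_order n N i) permutes {1..n}"
  by (rule perm_of_order_permutes) (use assms in \<open>auto simp: cyclic_order_def\<close>)

lemma host_best_response:
  assumes "n \<ge> 1" and "M > 0" and "\<And>i. i \<in> {1..n} \<Longrightarrow> 0 < \<alpha> i \<and> \<alpha> i < 1"
  shows "\<exists>y\<in>host_strategies n \<alpha> M C q'. \<forall>y'\<in>host_strategies n \<alpha> M C q'.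
           payoff n x y \<le> payoff n x y'"
proof -
  define c where "c i = x i * (\<alpha> i / (1 - \<alpha> i)) * M" for i
  define d where "d = (\<Sum>i=1..n. x i * (q' i * C))"
  have pay: "payoff n x (host_vec \<alpha> M C q' q) = (\<Sum>i=1..n. c i * q i) + d" for q
    unfolding payoff_def host_vec_def c_def d_def
    by (simp add: algebra_simps sum.distrib)
  obtain m where m: "m \<in> {1..n}" and min: "\<And>i. i \<in> {1..n} \<Longrightarrow> c m \<le> c i"
  proof -
    have "Min (c ` {1..n}) \<in> c ` {1..n}" using assms(1) by (intro Min_in) auto
    then obtain m where "m \<in> {1..n}" "c m = Min (c ` {1..n})" by (metis imageE)
    then show thesis by (intro that[of m]) auto
  qed
  let ?q = "\<lambda>i. if i = m then 1 else 0 :: real"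
  have "host_vec \<alpha> M C q' ?q \<in> host_strategies n \<alpha> M C q'"
    unfolding host_strategies_def using m by (auto intro!: exI[of _ ?q])
  moreover have "payoff n x (host_vec \<alpha> M C q' ?q) \<le> payoff n x y'"
    if y': "y' \<in> host_strategies n \<alpha> M C q'" for y'
  proof -
    obtain q where q: "y' = host_vec \<alpha> M C q' q" "\<forall>i\<in>{1..n}. 0 \<le> q i" "(\<Sum>i=1..n. q i) = 1"
      using y' unfolding host_strategies_def by blast
    have "(\<Sum>i=1..n. c i * ?q i) = (\<Sum>i=1..n. if i = m then c i else 0)"
      by (intro sum.cong) auto
    also have "\<dots> = c m" using m by simp
    also have "\<dots> = (\<Sum>i=1..n. c m * q i)" using q(3) by (simp flip: sum_distrib_left)
    also have "\<dots> \<le> (\<Sum>i=1..n. c i * q i)"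
      by (intro sum_mono mult_right_mono min) (use q in auto)
    finally show ?thesis unfolding q(1) pay by simp
  qed
  ultimately show ?thesis by blast
qed

lemma contestant_best_response:
  "\<exists>x\<in>contestant_strategies n \<alpha>. \<forall>x'\<in>contestant_strategies n \<alpha>. payoff n x' y \<le> payoff n x y"
proof -
  let ?P = "{\<sigma>. \<sigma> permutes {1..n}}"
  define c where "c \<sigma> = payoff n (contestant_vec n \<alpha> \<sigma>) y" for \<sigma>
  have fin: "finite ?P" by (simp add: finite_permutations)
  have pay: "payoff n (\<lambda>i. \<Sum>\<sigma>\<in>?P. p \<sigma> * contestant_vec n \<alpha> \<sigma> i) y = (\<Sum>\<sigma>\<in>?P. p \<sigma> * c \<sigma>)" for p
    unfolding payoff_def c_def sum_distrib_right sum_distrib_left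
    by (subst sum.swap) (simp add: mult.assoc)
  have "id \<in> ?P" by (simp add: permutes_id)
  then have ne: "c ` ?P \<noteq> {}" by blast
  obtain m where m: "m \<in> ?P" "c m = Max (c ` ?P)"
    using Max_in[OF finite_imageI[OF fin] ne] by auto
  have max: "c \<sigma> \<le> c m" if "\<sigma> \<in> ?P" for \<sigma>
    unfolding m(2) using fin that by (intro Max_ge) auto
  let ?p = "\<lambda>\<sigma>. if \<sigma> = m then 1 else 0 :: real"
  let ?x = "\<lambda>i. \<Sum>\<sigma>\<in>?P. ?p \<sigma> * contestant_vec n \<alpha> \<sigma> i"
  have "?x \<in> contestant_strategies n \<alpha>"
    unfolding contestant_strategies_def using m fin by (intro CollectI exI[of _ ?p]) auto
  moreover have "payoff n x' y \<le> payoff n ?x y" if x': "x' \<in> contestant_strategies n \<alpha>" for x'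
  proof -
    obtain p where p: "x' = (\<lambda>i. \<Sum>\<sigma>\<in>?P. p \<sigma> * contestant_vec n \<alpha> \<sigma> i)"
        "\<forall>\<sigma>. \<sigma> permutes {1..n} \<longrightarrow> 0 \<le> p \<sigma>" "(\<Sum>\<sigma>\<in>?P. p \<sigma>) = 1"
      using x' unfolding contestant_strategies_def by blast
    have "payoff n x' y \<le> (\<Sum>\<sigma>\<in>?P. p \<sigma> * c m)"
      unfolding p(1) pay by (intro sum_mono mult_left_mono max) (use p in auto)
    also have "\<dots> = c m" using p(3) by (simp flip: sum_distrib_right)
    also have "\<dots> = (\<Sum>\<sigma>\<in>?P. if \<sigma> = m then c \<sigma> else 0)" using m fin by simp
    also have "\<dots> = payoff n ?x y" unfolding pay by (intro sum.cong) auto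
    finally show ?thesis .
  qed
  ultimately show ?thesis by blast
qed

(* The total winnings when question i is answered correctly, if attempted, iff om i; the lemma
   below identifies their expectation with the bilinear payoff. *)

definition winnings ::
  "nat \<Rightarrow> real \<Rightarrow> real \<Rightarrow> (nat \<Rightarrow> real) \<Rightarrow> (nat \<Rightarrow> real) \<Rightarrow> (nat \<Rightarrow> nat) \<Rightarrow> (nat \<Rightarrow> bool) \<Rightarrow> real" where
  "winnings n M C q' q \<sigma> om =
     (\<Sum>k=1..n. if \<forall>l\<in>{1..<k}. om (\<sigma> l)
                then if om (\<sigma> k) then q (\<sigma> k) * M else q' (\<sigma> k) * C
                else 0)"

lemma expected_winnings:
  assumes \<sigma>: "\<sigma> permutes {1..n}" and \<alpha>: "\<And>i. i \<in> {1..n} \<Longrightarrow> 0 < \<alpha> i \<and> \<alpha> i < 1"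
    and nonneg: "M \<ge> 0" "C \<ge> 0" "\<And>i. i \<in> {1..n} \<Longrightarrow> 0 \<le> q i" "\<And>i. i \<in> {1..n} \<Longrightarrow> 0 \<le> q' i"
  shows "measure_pmf.expectation (Pi_pmf {1..n} False (\<lambda>i. bernoulli_pmf (\<alpha> i)))
           (winnings n M C q' q \<sigma>)
         = payoff n (contestant_vec n \<alpha> \<sigma>) (host_vec \<alpha> M C q' q)"
proof -
  let ?D = "Pi_pmf {1..n} False (\<lambda>i. bernoulli_pmf (\<alpha> i))"
  define B where "B i = {j \<in> {1..n}. inv \<sigma> j < inv \<sigma> i}" for i
  define h where "h i j b = (if j \<in> B i then of_bool b
      else if j = i then (if b then q i * M else q' i * C) else (1::real))" for i j b
  have win: "winnings n M C q' q \<sigma> om = (\<Sum>i=1..n. \<Prod>j=1..n. h i j (om j))" for om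
  proof -
    have "winnings n M C q' q \<sigma> om = (\<Sum>k=1..n. \<Prod>j=1..n. h (\<sigma> k) j (om j))"
      unfolding winnings_def
    proof (intro sum.cong refl)
      fix k assume k: "k \<in> {1..n}"
      have inv: "inv \<sigma> (\<sigma> l) = l" for l using permutes_inverses(2)[OF \<sigma>] .
      have inv': "\<sigma> (inv \<sigma> l) = l" for l using permutes_inverses(1)[OF \<sigma>] .
      have B: "B (\<sigma> k) = \<sigma> ` {1..<k}"
      proof (intro set_eqI iffI)
        fix j assume "j \<in> B (\<sigma> k)"
        then have j: "j \<in> {1..n}" "inv \<sigma> j < k" by (auto simp: B_def inv)
        then have "inv \<sigma> j \<in> {1..n}" using permutes_in_image[OF permutes_inv[OF \<sigma>]] by blast
        with j show "j \<in> \<sigma> ` {1..<k}" by (intro image_eqI[of _ _ "inv \<sigma> j"]) (auto simp: inv')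
      next
        fix j assume "j \<in> \<sigma> ` {1..<k}"
        then obtain l where l: "l \<in> {1..<k}" "j = \<sigma> l" by blast
        then have "j \<in> {1..n}" using permutes_in_image[OF \<sigma>, of l] k by auto
        with l show "j \<in> B (\<sigma> k)" by (auto simp: B_def inv)
      qed
      have kin: "\<sigma> k \<in> {1..n}" using permutes_in_image[OF \<sigma>] k by blast
      have kB: "\<sigma> k \<notin> B (\<sigma> k)" by (simp add: B_def)
      have Bs: "B (\<sigma> k) \<subseteq> {1..n}" by (auto simp: B_def)
      have finB: "finite (B (\<sigma> k))" using Bs finite_subset by blast
      have "(\<Prod>j=1..n. h (\<sigma> k) j (om j)) = (\<Prod>j\<in>insert (\<sigma> k) (B (\<sigma> k)). h (\<sigma> k) j (om j))"
        using kin Bs by (intro prod.mono_neutral_right) (auto simp: h_def)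
      also have "\<dots> = h (\<sigma> k) (\<sigma> k) (om (\<sigma> k)) * (\<Prod>j\<in>B (\<sigma> k). h (\<sigma> k) j (om j))"
        using finB kB by simp
      also have "(\<Prod>j\<in>B (\<sigma> k). h (\<sigma> k) j (om j)) = (\<Prod>j\<in>B (\<sigma> k). of_bool (om j))"
        by (intro prod.cong) (auto simp: h_def)
      also have "\<dots> = of_bool (\<forall>j\<in>B (\<sigma> k). om j)"
        using finB by (induction rule: finite_induct) auto
      also have "(\<forall>j\<in>B (\<sigma> k). om j) = (\<forall>l\<in>{1..<k}. om (\<sigma> l))" unfolding B by blast
      finally show "(if \<forall>l\<in>{1..<k}. om (\<sigma> l)
            then if om (\<sigma> k) then q (\<sigma> k) * M else q' (\<sigma> k) * C else 0)
          = (\<Prod>j=1..n. h (\<sigma> k) j (om j))"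
        using kB by (simp add: h_def)
    qed
    also have "\<dots> = (\<Sum>i=1..n. \<Prod>j=1..n. h i j (om j))"
      by (rule sum.permute[OF \<sigma>, symmetric, unfolded comp_def])
    finally show ?thesis .
  qed
  have fin: "finite (set_pmf ?D)"
    by (intro finite_subset[OF set_Pi_pmf_subset'])
       (auto intro!: finite_PiE_dflt)
  have "measure_pmf.expectation ?D (winnings n M C q' q \<sigma>)
      = (\<Sum>i=1..n. measure_pmf.expectation ?D (\<lambda>om. \<Prod>j=1..n. h i j (om j)))"
    unfolding win
    by (rule Bochner_Integration.integral_sum) (rule integrable_measure_pmf_finite[OF fin])
  also have "\<dots> = (\<Sum>i=1..n. contestant_vec n \<alpha> \<sigma> i * host_vec \<alpha> M C q' q i)"
  proof (intro sum.cong refl)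
    fix i assume i: "i \<in> {1..n}"
    have iB: "i \<notin> B i" by (simp add: B_def)
    have Bs: "B i \<subseteq> {1..n}" by (auto simp: B_def)
    have finB: "finite (B i)" using Bs finite_subset by blast
    have e: "measure_pmf.expectation (bernoulli_pmf (\<alpha> j)) (h i j)
        = \<alpha> j * h i j True + (1 - \<alpha> j) * h i j False" if "j \<in> {1..n}" for j
      using \<alpha>[OF that] by (subst integral_bernoulli_pmf) auto
    have "measure_pmf.expectation ?D (\<lambda>om. \<Prod>j=1..n. h i j (om j))
        = (\<Prod>j=1..n. measure_pmf.expectation (bernoulli_pmf (\<alpha> j)) (h i j))"
      using i nonneg
      by (intro expectation_prod_Pi_pmf)
         (auto simp: h_def intro!: integrable_measure_pmf_finite intro: finite_subset[OF subset_UNIV])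
    also have "\<dots> = (\<Prod>j=1..n. \<alpha> j * h i j True + (1 - \<alpha> j) * h i j False)"
      by (intro prod.cong refl e)
    also have "\<dots> = (\<Prod>j\<in>insert i (B i). \<alpha> j * h i j True + (1 - \<alpha> j) * h i j False)"
      using i Bs by (intro prod.mono_neutral_right) (auto simp: h_def)
    also have "\<dots> = (\<alpha> i * (q i * M) + (1 - \<alpha> i) * (q' i * C))
        * (\<Prod>j\<in>B i. \<alpha> j * h i j True + (1 - \<alpha> j) * h i j False)"
      using finB iB by (simp add: h_def)
    also have "(\<Prod>j\<in>B i. \<alpha> j * h i j True + (1 - \<alpha> j) * h i j False) = (\<Prod>j\<in>B i. \<alpha> j)"
      by (intro prod.cong) (auto simp: h_def)
    also have "\<alpha> i * (q i * M) + (1 - \<alpha> i) * (q' i * C)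
        = (1 - \<alpha> i) * host_vec \<alpha> M C q' q i"
      using \<alpha>[OF i] by (simp add: host_vec_def field_simps)
    finally show "measure_pmf.expectation ?D (\<lambda>om. \<Prod>j=1..n. h i j (om j))
        = contestant_vec n \<alpha> \<sigma> i * host_vec \<alpha> M C q' q i"
      by (simp add: contestant_vec_def B_def mult_ac)
  qed
  finally show ?thesis by (simp add: payoff_def)
qed

end

theory Submission
  imports Defs
begin

text \<open>
  It suffices to show that \<open>xstar\<close> secures at least \<open>v\<close> and that \<open>qstar\<close> concedes at most \<open>v\<close>.
  Averaging over the cyclic shifts telescopes, so that \<open>xstar\<close> makes the host indifferent between
  the questions up to \<open>N\<close>; the later questions are worse for him. On the other side,
  \<open>qstar\<close> makes the vector \<open>y\<close> constant up to \<open>N\<close>, and maximality of \<open>N\<close> makes it increasing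
  afterwards. For every order the sum of \<open>x i\<close> over a final segment \<open>{k..n}\<close> is at most
  \<open>1 - (\<Prod>i=k..n. \<alpha> i)\<close>, with equality for the decreasing order, so summation by parts shows that
  the decreasing order is a best response to \<open>y\<close>, and its payoff is \<open>v\<close>.
\<close>

section \<open>Saddle points\<close>

text \<open>Since \<open>y\<close> concedes at most \<open>v\<close>, every inner infimum is at most
  \<open>v\<close>; since \<open>x\<close> secures \<open>v\<close>, every inner supremum is at
  least \<open>v\<close>. Both bounds are attained at the pair itself. On the reals
  \<open>INF\<close> and \<open>SUP\<close> mean what they should only for bounded nonempty
  families, hence \<open>below\<close> and \<open>above\<close>.\<close>

lemma saddle_point:
  fixes f :: "'a \<Rightarrow> 'b \<Rightarrow> real"
  assumes x: "x \<in> X" and y: "y \<in> Y"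
    and lower: "\<And>y'. y' \<in> Y \<Longrightarrow> v \<le> f x y'"
    and upper: "\<And>x'. x' \<in> X \<Longrightarrow> f x' y \<le> v"
    and below: "\<And>x'. x' \<in> X \<Longrightarrow> bdd_below (f x' ` Y)"
    and above: "\<And>y'. y' \<in> Y \<Longrightarrow> bdd_above ((\<lambda>x'. f x' y') ` X)"
  shows "(INF y'\<in>Y. f x y') = v" "(SUP x'\<in>X. f x' y) = v"
    "(SUP x'\<in>X. INF y'\<in>Y. f x' y') = v" "(INF y'\<in>Y. SUP x'\<in>X. f x' y') = v"
proof -
  have inf_le: "(INF y'\<in>Y. f x' y') \<le> v" if "x' \<in> X" for x'
    using cINF_lower[OF below[OF that] y] upper[OF that] by linarith
  have sup_ge: "v \<le> (SUP x'\<in>X. f x' y')" if "y' \<in> Y" for y'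
    using cSUP_upper[OF x above[OF that]] lower[OF that] by linarith
  show inf: "(INF y'\<in>Y. f x y') = v"
    using y by (intro antisym inf_le x cINF_greatest lower) auto
  show sup: "(SUP x'\<in>X. f x' y) = v"
    using x by (intro antisym sup_ge y cSUP_least upper) auto
  show "(SUP x'\<in>X. INF y'\<in>Y. f x' y') = v"
  proof (rule antisym)
    show "(SUP x'\<in>X. INF y'\<in>Y. f x' y') \<le> v"
      using x by (intro cSUP_least inf_le) auto
    have "(INF y'\<in>Y. f x y') \<le> (SUP x'\<in>X. INF y'\<in>Y. f x' y')"
      by (intro cSUP_upper x bdd_aboveI2[where M = v] inf_le)
    then show "v \<le> (SUP x'\<in>X. INF y'\<in>Y. f x' y')" by (simp add: inf)
  qed
  show "(INF y'\<in>Y. SUP x'\<in>X. f x' y') = v"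
  proof (rule antisym)
    show "v \<le> (INF y'\<in>Y. SUP x'\<in>X. f x' y')"
      using y by (intro cINF_greatest sup_ge) auto
    have "(INF y'\<in>Y. SUP x'\<in>X. f x' y') \<le> (SUP x'\<in>X. f x' y)"
      by (intro cINF_lower y bdd_belowI2[where m = v] sup_ge)
    then show "(INF y'\<in>Y. SUP x'\<in>X. f x' y') \<le> v" by (simp add: sup)
  qed
qed

section \<open>Telescoping along an order\<close>

text \<open>If \<open>a i\<close> is the chance of success at \<open>i\<close> and attempts follow
  increasing \<open>r\<close>, each summand is the chance that \<open>i\<close> is the first
  failure, and the sum is the chance of any failure. Adding the element of largest rank leaves the
  earlier products unchanged.\<close>

lemma sum_one_minus_prod_before:
  fixes a :: "'a \<Rightarrow> 'c::comm_ring_1" and r :: "'a \<Rightarrow> 'b::linorder"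
  assumes "finite A" "inj_on r A"
  shows "(\<Sum>i\<in>A. (1 - a i) * (\<Prod>j | j \<in> A \<and> r j < r i. a j)) = 1 - (\<Prod>i\<in>A. a i)"
  using assms
proof (induction A rule: finite_ranking_induct[where f = r])
  case empty
  then show ?case by simp
next
  case (insert x S)
  show ?case
  \<comment> \<open>The ranking induction gives only \<open>r y \<le> r x\<close> on
    \<open>S\<close> and does not exclude \<open>x \<in> S\<close>; injectivity makes the inequality
    strict in the other case.\<close>
  proof (cases "x \<in> S")
    case True
    then show ?thesis using insert by (simp add: insert_absorb)
  next
    case False
    have lt: "r y < r x" if "y \<in> S" for y
      using insert that False by (metis inj_on_eq_iff insert_iff order_le_less)
    have "{j. j \<in> insert x S \<and> r j < r x} = S" using lt by auto
    moreover have "{j. j \<in> insert x S \<and> r j < r i} = {j. j \<in> S \<and> r j < r i}" if "i \<in> S" for i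
      using lt[OF that] by auto
    ultimately have "(\<Sum>i\<in>insert x S. (1 - a i) * (\<Prod>j | j \<in> insert x S \<and> r j < r i. a j))
        = (1 - a x) * prod a S + (\<Sum>i\<in>S. (1 - a i) * (\<Prod>j | j \<in> S \<and> r j < r i. a j))"
      using insert.hyps(1) False by simp
    then show ?thesis
      using insert False by (simp add: algebra_simps inj_on_insert)
  qed
qed

text \<open>This is the decreasing order \<open>n, ..., m\<close>, obtained by ranking with the
  negated index, which needs \<open>int\<close>.\<close>

lemma sum_one_minus_prod_tail:
  fixes a :: "nat \<Rightarrow> 'a::comm_ring_1"
  shows "(\<Sum>i=m..n. (1 - a i) * (\<Prod>j=i+1..n. a j)) = 1 - (\<Prod>i=m..n. a i)"
proof -
  have "(\<Sum>i=m..n. (1 - a i) * (\<Prod>j=i+1..n. a j))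
      = (\<Sum>i\<in>{m..n}. (1 - a i) * (\<Prod>j | j \<in> {m..n} \<and> - int j < - int i. a j))"
    by (intro sum.cong prod.cong refl arg_cong2[of _ _ _ _ "(*)"]) auto
  also have "\<dots> = 1 - (\<Prod>i=m..n. a i)"
    by (rule sum_one_minus_prod_before) (auto simp: inj_on_def)
  finally show ?thesis .
qed

section \<open>Best responses to a monotone vector\<close>

text \<open>Discarding the factors of questions outside \<open>A\<close> can only increase each
  product, and what remains telescopes along \<open>inv \<sigma>\<close>.\<close>

lemma sum_contestant_vec_le:
  assumes \<sigma>: "\<sigma> permutes {1..n}" and A: "A \<subseteq> {1..n}"
    and \<alpha>: "\<And>i. i \<in> {1..n} \<Longrightarrow> 0 \<le> \<alpha> i \<and> \<alpha> i \<le> 1"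
  shows "(\<Sum>i\<in>A. contestant_vec n \<alpha> \<sigma> i) \<le> 1 - (\<Prod>i\<in>A. \<alpha> i)"
proof -
  have fin: "finite A" using A finite_subset by blast
  have "contestant_vec n \<alpha> \<sigma> i \<le> (1 - \<alpha> i) * (\<Prod>j | j \<in> A \<and> inv \<sigma> j < inv \<sigma> i. \<alpha> j)"
    if i: "i \<in> A" for i
    unfolding contestant_vec_def
  proof (rule mult_left_mono)
    let ?B = "{j \<in> {1..n}. inv \<sigma> j < inv \<sigma> i}" and ?D = "{j. j \<in> A \<and> inv \<sigma> j < inv \<sigma> i}"
    have "prod \<alpha> ?B = prod \<alpha> (?B - ?D) * prod \<alpha> ?D"
      using A by (intro prod.subset_diff) auto
    also have "\<dots> \<le> 1 * prod \<alpha> ?D"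
      using \<alpha> A by (intro mult_right_mono prod_le_1 prod_nonneg) auto
    finally show "prod \<alpha> ?B \<le> prod \<alpha> ?D" by simp
  qed (use \<alpha> A i in auto)
  then have "(\<Sum>i\<in>A. contestant_vec n \<alpha> \<sigma> i)
      \<le> (\<Sum>i\<in>A. (1 - \<alpha> i) * (\<Prod>j | j \<in> A \<and> inv \<sigma> j < inv \<sigma> i. \<alpha> j))"
    by (rule sum_mono)
  also have "\<dots> = 1 - (\<Prod>i\<in>A. \<alpha> i)"
    using permutes_inj[OF permutes_inv[OF \<sigma>]] fin
    by (intro sum_one_minus_prod_before) (auto intro: inj_on_subset)
  finally show ?thesis .
qed

text \<open>Summation by parts: the increments of \<open>y\<close> are nonnegative and multiply
  tails of \<open>w\<close> that are at most \<open>0\<close>, so only the boundary term at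
  \<open>m\<close> is left. The induction runs downwards from \<open>n\<close>.\<close>

lemma sum_mono_weights_le_tails:
  fixes w y :: "nat \<Rightarrow> real"
  assumes "m \<le> n" and "\<And>k. k \<in> {m..n} \<Longrightarrow> (\<Sum>i=k..n. w i) \<le> 0"
    and "mono_on {m..n} y"
  shows "(\<Sum>i=m..n. w i * y i) \<le> y m * (\<Sum>i=m..n. w i)"
  using assms
proof (induction m rule: inc_induct)
  case base
  then show ?case by simp
next
  case (step m)
  have "(\<Sum>i=Suc m..n. w i * y i) \<le> y (Suc m) * (\<Sum>i=Suc m..n. w i)"
    using step.prems by (intro step.IH) (auto intro: mono_on_subset)
  also have "\<dots> \<le> y m * (\<Sum>i=Suc m..n. w i)"
    using step by (intro mult_right_mono_neg) (auto intro: mono_onD[where f = y])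
  finally show ?case
    using step.hyps by (simp add: sum.atLeast_Suc_atMost algebra_simps)
qed

lemma payoff_contestant_vec_le:
  assumes \<sigma>: "\<sigma> permutes {1..n}"
    and \<alpha>: "\<And>i. i \<in> {1..n} \<Longrightarrow> 0 \<le> \<alpha> i \<and> \<alpha> i \<le> 1"
    and y: "mono_on {1..n} y" and y_nonneg: "0 \<le> y 1"
  shows "payoff n (contestant_vec n \<alpha> \<sigma>) y \<le> (\<Sum>i=1..n. (1 - \<alpha> i) * (\<Prod>j=i+1..n. \<alpha> j) * y i)"
proof (cases "n = 0")
  case False
  \<comment> \<open>The difference between the vector of \<open>\<sigma>\<close> and that of the
    order \<open>n, ..., 1\<close>; the tail sums of the latter are exactly
    \<open>1 - (\<Prod>i=k..n. \<alpha> i)\<close>.\<close>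
  let ?w = "\<lambda>i. contestant_vec n \<alpha> \<sigma> i - (1 - \<alpha> i) * (\<Prod>j=i+1..n. \<alpha> j)"
  have tails: "(\<Sum>i=k..n. ?w i) \<le> 0" if "k \<in> {1..n}" for k
    using sum_contestant_vec_le[OF \<sigma> _ \<alpha>, of "{k..n}"] that
    by (simp add: sum_subtractf sum_one_minus_prod_tail[unfolded Suc_eq_plus1[symmetric]])
  have "(\<Sum>i=1..n. ?w i * y i) \<le> y 1 * (\<Sum>i=1..n. ?w i)"
    using False by (intro sum_mono_weights_le_tails tails y) auto
  also have "\<dots> \<le> 0"
    using False by (intro mult_nonneg_nonpos y_nonneg tails) auto
  finally show ?thesis by (simp only: payoff_def left_diff_distrib sum_subtractf diff_le_0_iff_le)
qed (simp add: payoff_def)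

section \<open>Mixed strategies\<close>

lemma payoff_mixture:
  "payoff n (\<lambda>i. \<Sum>s\<in>S. p s * x s i) y = (\<Sum>s\<in>S. p s * payoff n (x s) y)"
  unfolding payoff_def sum_distrib_right sum_distrib_left
  by (subst sum.swap) (simp add: mult.assoc)

lemma payoff_contestant_strategy_le:
  assumes x: "x \<in> contestant_strategies n \<alpha>"
    and bound: "\<And>\<sigma>. \<sigma> permutes {1..n} \<Longrightarrow> payoff n (contestant_vec n \<alpha> \<sigma>) y \<le> v"
  shows "payoff n x y \<le> v"
proof -
  obtain p where p: "x = (\<lambda>i. \<Sum>\<sigma> | \<sigma> permutes {1..n}. p \<sigma> * contestant_vec n \<alpha> \<sigma> i)"
      "\<And>\<sigma>. \<sigma> permutes {1..n} \<Longrightarrow> 0 \<le> p \<sigma>" "(\<Sum>\<sigma> | \<sigma> permutes {1..n}. p \<sigma>) = 1"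
    using x unfolding contestant_strategies_def by blast
  have "payoff n x y \<le> (\<Sum>\<sigma> | \<sigma> permutes {1..n}. p \<sigma> * v)"
    unfolding p(1) payoff_mixture by (intro sum_mono mult_left_mono) (use p bound in auto)
  then show ?thesis using p(3) by (simp flip: sum_distrib_right)
qed

text \<open>The family \<open>s\<close> need not be injective.\<close>

lemma mixture_in_contestant_strategies:
  assumes I: "finite I" and s: "\<And>i. i \<in> I \<Longrightarrow> s i permutes {1..n}"
    and p: "\<And>i. i \<in> I \<Longrightarrow> 0 \<le> p i" "(\<Sum>i\<in>I. p i) = 1"
  shows "(\<lambda>k. \<Sum>i\<in>I. p i * contestant_vec n \<alpha> (s i) k) \<in> contestant_strategies n \<alpha>"
proof -
  let ?P = "{\<sigma>. \<sigma> permutes {1..n}}"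
  \<comment> \<open>The image of the distribution \<open>p\<close> under \<open>s\<close>: indices
    with the same permutation pool their weights.\<close>
  define P where "P \<sigma> = (\<Sum>i | i \<in> I \<and> s i = \<sigma>. p i)" for \<sigma>
  have fin: "finite ?P" by (simp add: finite_permutations)
  \<comment> \<open>Stated for an arbitrary \<open>g\<close>, so that it gives both the entries of
    the mixture and, with \<open>g\<close> constantly \<open>1\<close>, the total mass.\<close>
  have collect: "(\<Sum>\<sigma>\<in>?P. P \<sigma> * g \<sigma>) = (\<Sum>i\<in>I. p i * g (s i))" for g :: "_ \<Rightarrow> real"
  proof -
    have "(\<Sum>\<sigma>\<in>?P. P \<sigma> * g \<sigma>) = (\<Sum>\<sigma>\<in>?P. \<Sum>i | i \<in> I \<and> s i = \<sigma>. p i * g (s i))"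
      unfolding P_def sum_distrib_right by (intro sum.cong) auto
    also have "\<dots> = (\<Sum>i\<in>I. p i * g (s i))"
      using s by (intro sum.group I fin) auto
    finally show ?thesis .
  qed
  show ?thesis
    unfolding contestant_strategies_def
  proof (intro CollectI exI[of _ P] conjI)
    show "(\<lambda>k. \<Sum>i\<in>I. p i * contestant_vec n \<alpha> (s i) k)
        = (\<lambda>k. \<Sum>\<sigma>\<in>?P. P \<sigma> * contestant_vec n \<alpha> \<sigma> k)"
      by (simp only: collect)
    show "\<forall>\<sigma>. \<sigma> permutes {1..n} \<longrightarrow> 0 \<le> P \<sigma>"
      unfolding P_def using p by (auto intro: sum_nonneg)
    show "sum P ?P = 1" using collect[of "\<lambda>_. 1"] p by simp
  qed
qed

section \<open>Contestant vectors of orders given as lists\<close>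

text \<open>Splitting the list at \<open>k\<close> shows the questions answered before
  \<open>k\<close> as \<open>set us\<close>, which removes the inverse permutation from
  \<open>contestant_vec\<close>.\<close>

lemma contestant_vec_perm_of_order:
  assumes dist: "distinct (us @ k # vs)" and set: "set (us @ k # vs) = {1..n}"
  shows "contestant_vec n \<alpha> (perm_of_order (us @ k # vs)) k = (1 - \<alpha> k) * prod \<alpha> (set us)"
proof -
  let ?xs = "us @ k # vs" and ?\<sigma> = "perm_of_order (us @ k # vs)"
  have inj: "inj ?\<sigma>" by (rule permutes_inj[OF perm_of_order_permutes[OF dist set]])
  \<comment> \<open>List indices start at \<open>0\<close>, positions in the order at
    \<open>1\<close>.\<close>
  have inv: "inv ?\<sigma> (?xs ! l) = Suc l" if "l < length ?xs" for l
    using inj that by (intro inv_f_eq) (auto simp: perm_of_order_def)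
  have k: "inv ?\<sigma> k = Suc (length us)"
    using inv[of "length us"] by simp
  have "{j \<in> {1..n}. inv ?\<sigma> j < inv ?\<sigma> k} = set us"
  proof (intro set_eqI iffI)
    fix j assume "j \<in> {j \<in> {1..n}. inv ?\<sigma> j < inv ?\<sigma> k}"
    then obtain l where l: "l < length ?xs" "j = ?xs ! l" and lt: "inv ?\<sigma> j < inv ?\<sigma> k"
      unfolding set[symmetric] in_set_conv_nth by blast
    then have "l < length us" using inv[OF l(1)] k by simp
    then show "j \<in> set us" using l by (simp add: nth_append)
  next
    fix j assume j: "j \<in> set us"
    then obtain l where l: "l < length us" "j = us ! l" by (metis in_set_conv_nth)
    then have "inv ?\<sigma> j = Suc l" using inv[of l] by (simp add: nth_append)
    moreover have "j \<in> {1..n}" using j set by auto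
    ultimately show "j \<in> {j \<in> {1..n}. inv ?\<sigma> j < inv ?\<sigma> k}" using l k by simp
  qed
  then show ?thesis by (simp add: contestant_vec_def)
qed

lemma upt_eq_append_Cons: "i \<le> k \<Longrightarrow> k < m \<Longrightarrow> [i..<m] = [i..<k] @ k # [k + 1..<m]"
  using upt_add_eq_append[of i k "m - k"] by (simp add: upt_conv_Cons)

context
  fixes n N i k :: nat
  assumes i: "i \<in> {1..N}" and N: "N \<le> n" and k: "k \<in> {1..n}"
begin

text \<open>Each of the next three lemmas exhibits such a splitting, according to the block of the
  list that holds \<open>k\<close>: the decreasing block above \<open>N\<close>, the run from
  \<open>i\<close> to \<open>N\<close>, or the wrapped-around run below \<open>i\<close>.\<close>

lemma contestant_vec_cyclic_order_split:
  assumes split: "cyclic_order n N i = us @ k # vs"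
  shows "contestant_vec n \<alpha> (perm_of_order (cyclic_order n N i)) k
    = (1 - \<alpha> k) * prod \<alpha> (set us)"
proof -
  have "distinct (cyclic_order n N i)" "set (cyclic_order n N i) = {1..n}"
    using i N by (auto simp: cyclic_order_def)
  then show ?thesis unfolding split by (rule contestant_vec_perm_of_order)
qed

lemma contestant_vec_cyclic_order_high:
  assumes "N < k"
  shows "contestant_vec n \<alpha> (perm_of_order (cyclic_order n N i)) k
    = (1 - \<alpha> k) * (\<Prod>j=k+1..n. \<alpha> j)"
proof -
  have "[N + 1..<n + 1] = [N + 1..<k] @ k # [k + 1..<n + 1]"
    using assms k by (intro upt_eq_append_Cons) auto
  then have "cyclic_order n N i
      = rev [k + 1..<n + 1] @ k # (rev [N + 1..<k] @ [i..<N + 1] @ [1..<i])"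
    by (simp add: cyclic_order_def)
  from contestant_vec_cyclic_order_split[OF this] show ?thesis
    by (simp add: atLeastLessThanSuc_atLeastAtMost del: upt_Suc)
qed

lemma contestant_vec_cyclic_order_mid:
  assumes "i \<le> k" "k \<le> N"
  shows "contestant_vec n \<alpha> (perm_of_order (cyclic_order n N i)) k
    = (1 - \<alpha> k) * ((\<Prod>j=N+1..n. \<alpha> j) * (\<Prod>j=i..<k. \<alpha> j))"
proof -
  have "[i..<N + 1] = [i..<k] @ k # [k + 1..<N + 1]"
    using assms by (intro upt_eq_append_Cons) auto
  then have "cyclic_order n N i
      = (rev [N + 1..<n + 1] @ [i..<k]) @ k # ([k + 1..<N + 1] @ [1..<i])"
    by (simp add: cyclic_order_def)
  from contestant_vec_cyclic_order_split[OF this] show ?thesis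
    using assms by (subst (asm) set_append, subst (asm) prod.union_disjoint)
      (auto simp: atLeastLessThanSuc_atLeastAtMost simp del: upt_Suc)
qed

lemma contestant_vec_cyclic_order_low:
  assumes "k < i"
  shows "contestant_vec n \<alpha> (perm_of_order (cyclic_order n N i)) k
    = (1 - \<alpha> k) * ((\<Prod>j=N+1..n. \<alpha> j) * ((\<Prod>j=i..N. \<alpha> j) * (\<Prod>j=1..<k. \<alpha> j)))"
proof -
  have "[1..<i] = [1..<k] @ k # [k + 1..<i]"
    using assms k by (intro upt_eq_append_Cons) auto
  then have "cyclic_order n N i
      = (rev [N + 1..<n + 1] @ [i..<N + 1] @ [1..<k]) @ k # [k + 1..<i]"
    by (simp add: cyclic_order_def)
  note contestant_vec_cyclic_order_split[OF this]
  moreover have "prod \<alpha> ({N+1..n} \<union> ({i..N} \<union> {1..<k}))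
      = (\<Prod>j=N+1..n. \<alpha> j) * ((\<Prod>j=i..N. \<alpha> j) * (\<Prod>j=1..<k. \<alpha> j))"
    using assms i by (subst prod.union_disjoint; (subst prod.union_disjoint)?) auto
  ultimately show ?thesis
    by (simp add: atLeastLessThanSuc_atLeastAtMost del: upt_Suc)
qed

end

section \<open>Averaging over the cyclic shifts\<close>

text \<open>The shifts with \<open>i \<le> k\<close> and those with \<open>i > k\<close> telescope
  separately, to multiples of \<open>1 - (\<Prod>j=1..k. \<alpha> j)\<close> and
  \<open>(\<Prod>j=1..k. \<alpha> j) * (1 - (\<Prod>j=k+1..N. \<alpha> j))\<close>. The sum of these
  no longer involves \<open>k\<close>, so \<open>k\<close> survives only in the odds in
  front.\<close>

lemma sum_cyclic_order:
  assumes N: "N \<le> n" and k: "k \<in> {1..N}" and \<alpha>: "\<And>i. i \<in> {1..N} \<Longrightarrow> \<alpha> i \<noteq> 0"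
  shows "(\<Sum>i=1..N. (1 - \<alpha> i) / \<alpha> i * contestant_vec n \<alpha> (perm_of_order (cyclic_order n N i)) k)
    = (1 - \<alpha> k) / \<alpha> k * ((\<Prod>j=N+1..n. \<alpha> j) * (1 - (\<Prod>j=1..N. \<alpha> j)))"
proof -
  define T where "T = (\<Prod>j=N+1..n. \<alpha> j)"
  let ?c = "\<lambda>i. (1 - \<alpha> i) / \<alpha> i * contestant_vec n \<alpha> (perm_of_order (cyclic_order n N i)) k"
  let ?g = "(1 - \<alpha> k) / \<alpha> k * T"
  have k0: "\<alpha> k \<noteq> 0" using \<alpha> k by blast
  have last: "(\<Prod>j=i..<k. \<alpha> j) * \<alpha> k = (\<Prod>j=i..k. \<alpha> j)" if "i \<le> k" for i
    using that by (simp add: prod.last_plus mult.commute)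
  have first: "(\<Prod>j=i..m. \<alpha> j) = \<alpha> i * (\<Prod>j=i+1..m. \<alpha> j)" if "i \<le> m" for i m
    using that by (simp add: prod.atLeast_Suc_atMost)
  \<comment> \<open>The division by \<open>\<alpha> i\<close> cancels the first factor of the
    product from \<open>i\<close>, which leaves the summand of
    \<open>sum_one_minus_prod_tail\<close>; the division by \<open>\<alpha> k\<close> in
    \<open>?g\<close> pays for including \<open>k\<close> in the product.\<close>
  have mid: "?c i = ?g * ((1 - \<alpha> i) * (\<Prod>j=i+1..k. \<alpha> j))" if "i \<in> {1..k}" for i
  proof -
    have i0: "\<alpha> i \<noteq> 0" using \<alpha> k that by auto
    have "contestant_vec n \<alpha> (perm_of_order (cyclic_order n N i)) k
        = (1 - \<alpha> k) * (T * (\<Prod>j=i..<k. \<alpha> j))"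
      unfolding T_def using that k N by (intro contestant_vec_cyclic_order_mid) auto
    also have "(\<Prod>j=i..<k. \<alpha> j) = \<alpha> i * (\<Prod>j=i+1..k. \<alpha> j) / \<alpha> k"
      using last[of i] first[of i k] that k0 by (simp add: field_simps)
    finally show ?thesis using i0 k0 by simp
  qed
  have low: "?c i = ?g * (\<Prod>j=1..k. \<alpha> j) * ((1 - \<alpha> i) * (\<Prod>j=i+1..N. \<alpha> j))"
    if "i \<in> {k+1..N}" for i
  proof -
    have i0: "\<alpha> i \<noteq> 0" using \<alpha> k that by auto
    have "contestant_vec n \<alpha> (perm_of_order (cyclic_order n N i)) k
        = (1 - \<alpha> k) * (T * ((\<Prod>j=i..N. \<alpha> j) * (\<Prod>j=1..<k. \<alpha> j)))"
      unfolding T_def using that k N by (intro contestant_vec_cyclic_order_low) auto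
    also have "(\<Prod>j=1..<k. \<alpha> j) = (\<Prod>j=1..k. \<alpha> j) / \<alpha> k"
      using last[of 1] k k0 by (simp add: field_simps)
    also have "(\<Prod>j=i..N. \<alpha> j) = \<alpha> i * (\<Prod>j=i+1..N. \<alpha> j)"
      using first[of i N] that by simp
    finally show ?thesis using i0 k0 by simp
  qed
  have "(\<Sum>i=1..N. ?c i) = (\<Sum>i=1..k. ?c i) + (\<Sum>i=k+1..N. ?c i)"
    using sum.ub_add_nat[of 1 k ?c "N - k"] k by simp
  also have "(\<Sum>i=1..k. ?c i) = ?g * (\<Sum>i=1..k. (1 - \<alpha> i) * (\<Prod>j=i+1..k. \<alpha> j))"
    unfolding sum_distrib_left using mid by (intro sum.cong) auto
  also have "\<dots> = ?g * (1 - (\<Prod>j=1..k. \<alpha> j))"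
    by (simp only: sum_one_minus_prod_tail)
  also have "(\<Sum>i=k+1..N. ?c i)
      = ?g * (\<Prod>j=1..k. \<alpha> j) * (\<Sum>i=k+1..N. (1 - \<alpha> i) * (\<Prod>j=i+1..N. \<alpha> j))"
    unfolding sum_distrib_left using low by (intro sum.cong) auto
  also have "\<dots> = ?g * (\<Prod>j=1..k. \<alpha> j) * (1 - (\<Prod>j=k+1..N. \<alpha> j))"
    by (simp only: sum_one_minus_prod_tail)
  also have "?g * (1 - (\<Prod>j=1..k. \<alpha> j)) + ?g * (\<Prod>j=1..k. \<alpha> j) * (1 - (\<Prod>j=k+1..N. \<alpha> j))
      = ?g * (1 - (\<Prod>j=1..k. \<alpha> j) * (\<Prod>j=k+1..N. \<alpha> j))"
    by (simp only: algebra_simps)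
  also have "(\<Prod>j=1..k. \<alpha> j) * (\<Prod>j=k+1..N. \<alpha> j) = (\<Prod>j=1..N. \<alpha> j)"
    using prod.ub_add_nat[of 1 k \<alpha> "N - k"] k by simp
  finally show ?thesis unfolding T_def by (simp only: mult.assoc)
qed

text \<open>Adding \<open>x\<close> raises the left side by \<open>(1 - a x) * prod a A\<close>,
  which is at most \<open>1 - a x\<close> and so at most the odds added on the right. In the theorem
  this bounds \<open>(1 - Q) / R\<close> by \<open>1\<close>.\<close>

lemma one_minus_prod_le_sum_odds:
  fixes a :: "'a \<Rightarrow> real"
  assumes "finite A" "\<And>i. i \<in> A \<Longrightarrow> 0 < a i \<and> a i \<le> 1"
  shows "1 - (\<Prod>i\<in>A. a i) \<le> (\<Sum>i\<in>A. (1 - a i) / a i)"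
  using assms
proof (induction A rule: finite_induct)
  case (insert x A)
  have ax: "0 < a x" "a x \<le> 1" using insert.prems by auto
  have "1 - prod a A \<le> (\<Sum>i\<in>A. (1 - a i) / a i)" by (intro insert.IH insert.prems) auto
  moreover have "(1 - a x) * prod a A \<le> (1 - a x) / a x"
  proof -
    have "prod a A \<le> 1" using insert.prems by (intro prod_le_1) (auto intro: less_imp_le)
    then have "(1 - a x) * prod a A \<le> (1 - a x) * 1" using ax by (intro mult_left_mono) auto
    also have "\<dots> \<le> (1 - a x) / a x" using ax by (simp add: divide_simps mult_left_le)
    finally show ?thesis .
  qed
  ultimately show ?case using insert.hyps by (simp add: algebra_simps)
qed simp

theorem theorem1:
  fixes n N :: nat and \<alpha> q' pstar qstar xstar :: "nat \<Rightarrow> real" and M C :: real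
  assumes n: "n \<ge> 1"
    and \<alpha>: "\<And>i. i \<in> {1..n} \<Longrightarrow> 0 < \<alpha> i \<and> \<alpha> i < 1"
    and M: "M > 0" and C: "C > 0"
    and q'_nonneg: "\<And>i. i \<in> {1..n} \<Longrightarrow> 0 \<le> q' i"
    and q'_sum: "(\<Sum>i=1..n. q' i) = 1"
    and q'_mono: "strict_mono_on {1..n} q'"
    and N: "N = Max {k \<in> {1..n}. (\<Sum>j=1..<k. (q' k - q' j) * ((1 - \<alpha> j) / \<alpha> j)) \<le> M / C}"
    and pstar: "\<And>i. i \<in> {1..N} \<Longrightarrow>
        pstar i = ((1 - \<alpha> i) / \<alpha> i) / (\<Sum>j=1..N. (1 - \<alpha> j) / \<alpha> j)"
    and xstar: "xstar =
        (\<lambda>k. \<Sum>i=1..N. pstar i * contestant_vec n \<alpha> (perm_of_order (cyclic_order n N i)) k)"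
    and qstar_le: "\<And>i. i \<in> {1..N} \<Longrightarrow>
        qstar i = C * (1 - \<alpha> i) / (M * \<alpha> i * (\<Sum>j=1..N. (1 - \<alpha> j) / \<alpha> j)) *
          (M / C + (\<Sum>j=1..N. (1 - \<alpha> j) * q' j / \<alpha> j) - q' i * (\<Sum>j=1..N. (1 - \<alpha> j) / \<alpha> j))"
    and qstar_gt: "\<And>i. i \<in> {N+1..n} \<Longrightarrow> qstar i = 0"
  shows "optimal_contestant n \<alpha> M C q' xstar \<and>
    optimal_host n \<alpha> M C q' (host_vec \<alpha> M C q' qstar) \<and>
    is_game_value n \<alpha> M C q'
      ((\<Prod>j=N+1..n. \<alpha> j) * ((1 - (\<Prod>j=1..N. \<alpha> j)) / (\<Sum>j=1..N. (1 - \<alpha> j) / \<alpha> j)) *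
         (M + C * (\<Sum>j=1..N. (1 - \<alpha> j) / \<alpha> j * q' j)) +
       C * (\<Sum>j=N+1..n. q' j * (1 - \<alpha> j) * (\<Prod>i=j+1..n. \<alpha> i)))"
proof -

  \<comment> \<open>Odds of failure and the threshold \<open>N\<close>\<close>
  define r where "r i = (1 - \<alpha> i) / \<alpha> i" for i
  define R where "R = (\<Sum>j=1..N. r j)"
  define S where "S = (\<Sum>j=1..N. r j * q' j)"
  define T where "T = (\<Prod>j=N+1..n. \<alpha> j)"
  define Q where "Q = (\<Prod>j=1..N. \<alpha> j)"
  define W where "W = C * (\<Sum>j=N+1..n. q' j * (1 - \<alpha> j) * (\<Prod>i=j+1..n. \<alpha> i))"
  \<comment> \<open>In the decreasing order, \<open>W\<close> is the expected consolation from
    questions above \<open>N\<close>, \<open>T\<close> the chance of getting past them, and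
    \<open>1 - Q\<close> the chance of then failing on one up to \<open>N\<close>;
    \<open>(M + C * S) / R\<close> is the common value of the host's vector there.\<close>
  define v where "v = T * ((1 - Q) / R) * (M + C * S) + W"
  let ?K = "{k \<in> {1..n}. (\<Sum>j=1..<k. (q' k - q' j) * r j) \<le> M / C}"
  let ?y = "host_vec \<alpha> M C q' qstar"
  have NK: "N = Max ?K" using N by (simp add: r_def)
  \<comment> \<open>For \<open>k = 1\<close> the sum is empty, so \<open>Max\<close> is taken over a
    nonempty set.\<close>
  have "1 \<in> ?K" using n M C by simp
  then have "N \<in> ?K" unfolding NK by (intro Max_in) auto
  then have N1: "N \<in> {1..n}" and N_le: "(\<Sum>j=1..<N. (q' N - q' j) * r j) \<le> M / C" by auto
  have above_N: "M / C < (\<Sum>j=1..<k. (q' k - q' j) * r j)" if "k \<in> {N+1..n}" for k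
  proof (rule ccontr)
    assume "\<not> ?thesis"
    then have "k \<in> ?K" using that by auto
    then have "k \<le> N" unfolding NK by (intro Max_ge) auto
    then show False using that by simp
  qed
  have r_pos: "0 < r i" if "i \<in> {1..n}" for i using \<alpha>[OF that] by (simp add: r_def)
  have R_pos: "0 < R" unfolding R_def using N1 r_pos by (intro sum_pos) auto
  \<comment> \<open>Closed form of the sum defining the threshold; it is applied with
    \<open>c = q' N\<close> and \<open>c = q' (N + 1)\<close>.\<close>
  have up_to_N: "(\<Sum>j=1..N. (c - q' j) * r j) = c * R - S" for c
    by (simp add: R_def S_def sum_subtractf sum_distrib_left algebra_simps)
  have q'_less: "q' i < q' j" if "i \<in> {1..n}" "j \<in> {1..n}" "i < j" for i j
    using strict_mono_onD[OF q'_mono] that by blast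
  have q'_le: "q' i \<le> q' j" if "i \<in> {1..n}" "j \<in> {1..n}" "i \<le> j" for i j
    using q'_less[of i j] that by (cases "i = j") auto
  have split_N: "(\<Sum>i=1..n. f i) = (\<Sum>i=1..N. f i) + (\<Sum>i=N+1..n. f i)" for f :: "nat \<Rightarrow> real"
    using sum.ub_add_nat[of 1 N f "n - N"] N1 by simp

  \<comment> \<open>The guarantee of the contestant\<close>
  have pstar': "pstar i = r i / R" if "i \<in> {1..N}" for i
    using pstar[OF that] by (simp add: r_def R_def)
  have p_sum: "(\<Sum>i=1..N. pstar i) = 1"
    using R_pos by (simp add: pstar' R_def flip: sum_divide_distrib)
  have x_in: "xstar \<in> contestant_strategies n \<alpha>"
    unfolding xstar
    using N1 R_pos r_pos
    by (intro mixture_in_contestant_strategies p_sum cyclic_order_permutes)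
      (auto simp: pstar' intro!: divide_nonneg_pos less_imp_le)
  have x_le: "xstar k = r k * (T * ((1 - Q) / R))" if k: "k \<in> {1..N}" for k
  proof -
    have "xstar k
        = (\<Sum>i=1..N. r i * contestant_vec n \<alpha> (perm_of_order (cyclic_order n N i)) k) / R"
      unfolding xstar sum_divide_distrib by (intro sum.cong) (auto simp: pstar')
    also have "(\<Sum>i=1..N. r i * contestant_vec n \<alpha> (perm_of_order (cyclic_order n N i)) k)
        = r k * (T * (1 - Q))"
      unfolding r_def T_def Q_def
    proof (rule sum_cyclic_order)
      show "\<alpha> i \<noteq> 0" if "i \<in> {1..N}" for i using \<alpha>[of i] that N1 by auto
    qed (use k N1 in auto)
    finally show ?thesis by simp
  qed
  \<comment> \<open>All the shifts share the initial block above \<open>N\<close>, so averaging has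
    no effect here.\<close>
  have x_gt: "xstar k = (1 - \<alpha> k) * (\<Prod>j=k+1..n. \<alpha> j)" if k: "k \<in> {N+1..n}" for k
  proof -
    have "xstar k = (\<Sum>i=1..N. pstar i * ((1 - \<alpha> k) * (\<Prod>j=k+1..n. \<alpha> j)))"
      unfolding xstar
    proof (intro sum.cong refl arg_cong2[of _ _ _ _ "(*)"])
      show "contestant_vec n \<alpha> (perm_of_order (cyclic_order n N i)) k
          = (1 - \<alpha> k) * (\<Prod>j=k+1..n. \<alpha> j)" if "i \<in> {1..N}" for i
        by (rule contestant_vec_cyclic_order_high) (use that k N1 in auto)
    qed
    then show ?thesis using p_sum by (simp flip: sum_distrib_right)
  qed
  \<comment> \<open>Main prize money placed on \<open>k\<close> costs the host
    \<open>xstar k / r k\<close> per unit; \<open>l\<close> is this rate for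
    \<open>k \<le> N\<close>, and \<open>l_le\<close> shows that no question is cheaper.\<close>
  define l where "l = T * ((1 - Q) / R)"
  have T_nonneg: "0 \<le> T" unfolding T_def using \<alpha> by (intro prod_nonneg) (auto intro: less_imp_le)
  have l_le_T: "l \<le> T"
  proof -
    have "1 - Q \<le> R"
      unfolding Q_def R_def r_def
      using N1 \<alpha> by (intro one_minus_prod_le_sum_odds) (auto intro: less_imp_le)
    then have "T * ((1 - Q) / R) \<le> T * 1"
      using R_pos T_nonneg by (intro mult_left_mono) auto
    then show ?thesis by (simp add: l_def)
  qed
  have l_le: "l \<le> xstar k / r k" if k: "k \<in> {1..n}" for k
  proof (cases "k \<le> N")
    case True
    then show ?thesis using x_le[of k] k r_pos[OF k] by (simp add: l_def)
  next
    case False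
    \<comment> \<open>For \<open>k > N\<close> the rate is the product over \<open>{k..n}\<close>,
      which has fewer factors than \<open>T\<close> and is therefore at least
      \<open>T\<close>.\<close>
    have "T = prod \<alpha> ({N+1..n} - {k..n}) * prod \<alpha> {k..n}"
      unfolding T_def using False by (intro prod.subset_diff) auto
    also have "\<dots> \<le> 1 * prod \<alpha> {k..n}"
      using \<alpha> k by (intro mult_right_mono prod_le_1 prod_nonneg) (auto intro: less_imp_le)
    also have "\<dots> = xstar k / r k"
      using False k \<alpha>[OF k] x_gt[of k] by (simp add: r_def prod.atLeast_Suc_atMost)
    finally show ?thesis using l_le_T by linarith
  qed
  \<comment> \<open>The consolation part of the payoff, which does not depend on the choice of the
    host.\<close>
  have x_const: "(\<Sum>k=1..n. xstar k * (q' k * C)) = C * S * l + W"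
  proof -
    have "(\<Sum>k=1..N. xstar k * (q' k * C)) = C * S * l"
      unfolding S_def sum_distrib_left sum_distrib_right
      by (intro sum.cong) (auto simp: x_le l_def)
    moreover have "(\<Sum>k=N+1..n. xstar k * (q' k * C)) = W"
      unfolding W_def sum_distrib_left by (intro sum.cong) (auto simp: x_gt)
    ultimately show ?thesis unfolding split_N by simp
  qed
  have lower: "v \<le> payoff n xstar y" if y: "y \<in> host_strategies n \<alpha> M C q'" for y
  proof -
    obtain q where q: "y = host_vec \<alpha> M C q' q" "\<And>i. i \<in> {1..n} \<Longrightarrow> 0 \<le> q i" "(\<Sum>i=1..n. q i) = 1"
      using y unfolding host_strategies_def by blast
    have "payoff n xstar y = (\<Sum>k=1..n. xstar k / r k * (q k * M)) + (\<Sum>k=1..n. xstar k * (q' k * C))"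
      unfolding q(1) payoff_def host_vec_def sum.distrib[symmetric]
      by (intro sum.cong) (auto simp: r_def algebra_simps)
    moreover have "(\<Sum>k=1..n. l * (q k * M)) \<le> (\<Sum>k=1..n. xstar k / r k * (q k * M))"
      by (intro sum_mono mult_right_mono l_le) (use q M in auto)
    moreover have "(\<Sum>k=1..n. l * (q k * M)) = l * M"
      using q(3) by (simp flip: sum_distrib_left sum_distrib_right)
    moreover have "v = l * M + (C * S * l + W)"
      by (simp add: v_def l_def distrib_left)
    ultimately show ?thesis
      unfolding x_const by linarith
  qed

  \<comment> \<open>The guarantee of the host\<close>
  have qstar': "qstar i = C * r i / (M * R) * (M / C + S - q' i * R)" if "i \<in> {1..N}" for i
    using qstar_le[OF that] by (simp add: r_def R_def S_def)
  have q_nonneg: "0 \<le> qstar i" if i: "i \<in> {1..n}" for i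
  proof (cases "i \<le> N")
    case True
    \<comment> \<open>The term \<open>j = N\<close> of the threshold sum is zero, so the sum may run
      up to \<open>N\<close>. As \<open>q'\<close> is increasing, the bracket in
      \<open>qstar\<close> is smallest at \<open>i = N\<close>, where its sign is the condition
      \<open>N \<in> ?K\<close>.\<close>
    have "{1..N} = insert N {1..<N}" using N1 by auto
    then have "q' N * R - S \<le> M / C" using N_le up_to_N[of "q' N"] by simp
    moreover have "q' i * R \<le> q' N * R"
      using q'_le[of i N] True i N1 R_pos by (intro mult_right_mono) auto
    ultimately have "0 \<le> M / C + S - q' i * R" by linarith
    then show ?thesis
      using qstar'[of i] True i C M R_pos r_pos[OF i] by auto
  qed (use qstar_gt i in auto)
  have q_sum: "(\<Sum>i=1..n. qstar i) = 1"
  proof -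
    have "(\<Sum>i=1..n. qstar i) = (\<Sum>i=1..N. qstar i)"
      unfolding split_N using qstar_gt by simp
    also have "\<dots> = C / (M * R) * ((M / C + S) * R - R * S)"
    proof -
      have "(\<Sum>i=1..N. qstar i) = (\<Sum>i=1..N. C / (M * R) * ((M / C + S) * r i - R * (r i * q' i)))"
        by (intro sum.cong) (use C M R_pos in \<open>auto simp: qstar' field_simps\<close>)
      also have "\<dots> = C / (M * R) * ((M / C + S) * (\<Sum>i=1..N. r i) - R * (\<Sum>i=1..N. r i * q' i))"
        by (simp only: sum_distrib_left[symmetric] sum_subtractf)
      finally show ?thesis by (simp only: R_def S_def)
    qed
    also have "\<dots> = 1" using C M R_pos by (simp add: field_simps)
    finally show ?thesis .
  qed
  have y_in: "?y \<in> host_strategies n \<alpha> M C q'"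
    unfolding host_strategies_def using q_nonneg q_sum by blast
  \<comment> \<open>Making \<open>?y i\<close> equal to \<open>\<mu>\<close> for
    \<open>i \<le> N\<close> requires \<open>qstar i * M = r i * (\<mu> - C * q' i)\<close>; summing
    to \<open>M\<close> gives \<open>\<mu> * R - C * S = M\<close>.\<close>
  define \<mu> where "\<mu> = (M + C * S) / R"
  have y_le: "?y i = \<mu>" if i: "i \<in> {1..N}" for i
  proof -
    have "?y i = 1 / r i * qstar i * M + q' i * C"
      by (simp add: host_vec_def r_def)
    also have "\<dots> = \<mu>"
      using C M R_pos r_pos[of i] i N1 by (simp add: qstar'[OF i] \<mu>_def field_simps)
    finally show ?thesis .
  qed
  have y_gt: "?y i = C * q' i" if "i \<in> {N+1..n}" for i
    using qstar_gt[OF that] by (simp add: host_vec_def)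
  have S_nonneg: "0 \<le> S"
    unfolding S_def using N1 q'_nonneg r_pos by (intro sum_nonneg mult_nonneg_nonneg)
      (auto intro: less_imp_le)
  have \<mu>_le: "\<mu> \<le> C * q' i" if i: "i \<in> {N+1..n}" for i
  proof -
    \<comment> \<open>The failure of the threshold condition at \<open>N + 1\<close> says exactly
      that \<open>\<mu> < C * q' (N + 1)\<close>.\<close>
    have "M / C < q' (N + 1) * R - S"
      using above_N[of "N + 1"] i up_to_N[of "q' (N + 1)"]
      by (simp add: atLeastLessThanSuc_atLeastAtMost)
    also have "\<dots> \<le> q' i * R - S"
      using q'_le[of "N + 1" i] i R_pos by (simp add: mult_right_mono)
    finally show ?thesis using C R_pos by (simp add: \<mu>_def field_simps)
  qed
  have y_mono: "mono_on {1..n} ?y"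
  proof (rule mono_onI)
    fix i j assume ij: "i \<in> {1..n}" "j \<in> {1..n}" "i \<le> j"
    consider "j \<le> N" | "i \<le> N" "N < j" | "N < i" by linarith
    then show "?y i \<le> ?y j"
    proof cases
      case 3
      then show ?thesis using ij y_gt q'_le[OF ij] C by simp
    qed (use ij y_le y_gt \<mu>_le in auto)
  qed
  have "0 \<le> ?y 1" using y_le[of 1] N1 C M S_nonneg R_pos by (simp add: \<mu>_def)
  then have upper_pure: "payoff n (contestant_vec n \<alpha> \<sigma>) ?y \<le> v" if "\<sigma> permutes {1..n}" for \<sigma>
  proof -
    let ?z = "\<lambda>i. (1 - \<alpha> i) * (\<Prod>j=i+1..n. \<alpha> j)"
    have "payoff n (contestant_vec n \<alpha> \<sigma>) ?y \<le> (\<Sum>i=1..n. ?z i * ?y i)"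
      using \<open>0 \<le> ?y 1\<close> \<alpha>
      by (intro payoff_contestant_vec_le that y_mono) (auto intro: less_imp_le)
    also have "\<dots> = (\<Sum>i=1..N. ?z i * ?y i) + (\<Sum>i=N+1..n. ?z i * ?y i)"
      by (rule split_N)
    also have "(\<Sum>i=N+1..n. ?z i * ?y i) = W"
      unfolding W_def sum_distrib_left by (intro sum.cong) (auto simp: y_gt)
    also have "(\<Sum>i=1..N. ?z i * ?y i) = (\<Sum>i=1..N. ?z i) * \<mu>"
      unfolding sum_distrib_right by (intro sum.cong) (auto simp: y_le)
    \<comment> \<open>The products in \<open>?z\<close> run up to \<open>n\<close>, so the tail
      identity applies to \<open>{1..n}\<close> and \<open>{N+1..n}\<close>, and the difference is
      taken.\<close>
    also have "(\<Sum>i=1..N. ?z i) = (1 - (\<Prod>i=1..n. \<alpha> i)) - (1 - T)"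
      unfolding T_def sum_one_minus_prod_tail[symmetric] by (simp only: split_N add_diff_cancel)
    also have "(\<Prod>i=1..n. \<alpha> i) = Q * T"
      using prod.ub_add_nat[of 1 N \<alpha> "n - N"] N1 by (simp add: Q_def T_def)
    also have "((1 - Q * T) - (1 - T)) * \<mu> + W = v"
      by (simp add: v_def \<mu>_def algebra_simps diff_divide_distrib add_divide_distrib)
    finally show ?thesis .
  qed

  \<comment> \<open>Optimality and the value\<close>
  \<comment> \<open>The payoff of a best response bounds all the others, which supplies the
    boundedness required by \<open>saddle_point\<close>.\<close>
  have below: "bdd_below (payoff n x ` host_strategies n \<alpha> M C q')" for x
    using host_best_response[OF n M \<alpha>, where x = x and C = C and q' = q'] by (meson bdd_belowI2)
  have above: "bdd_above ((\<lambda>x. payoff n x y) ` contestant_strategies n \<alpha>)" for y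
    using contestant_best_response[of n \<alpha> y] by (meson bdd_aboveI2)
  note upper = payoff_contestant_strategy_le[OF _ upper_pure]
  have saddle: "(INF y\<in>host_strategies n \<alpha> M C q'. payoff n xstar y) = v"
    "(SUP x\<in>contestant_strategies n \<alpha>. payoff n x ?y) = v"
    "maximin n \<alpha> M C q' = v" "minimax n \<alpha> M C q' = v"
    unfolding maximin_def minimax_def
    by (rule saddle_point[OF x_in y_in lower upper below above]; assumption)+
  have v_eq: "(\<Prod>j=N+1..n. \<alpha> j) * ((1 - (\<Prod>j=1..N. \<alpha> j)) / (\<Sum>j=1..N. (1 - \<alpha> j) / \<alpha> j)) *
         (M + C * (\<Sum>j=1..N. (1 - \<alpha> j) / \<alpha> j * q' j)) +
       C * (\<Sum>j=N+1..n. q' j * (1 - \<alpha> j) * (\<Prod>i=j+1..n. \<alpha> i)) = v"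
    unfolding v_def T_def Q_def R_def S_def W_def r_def ..
  show ?thesis
    unfolding v_eq optimal_contestant_def optimal_host_def is_game_value_def
    using x_in y_in saddle by simp
qed

end
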